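(* The bound function $$B_{\mathrm{lin},\chi^2}(Q)=\sum_{i=1}^H\hat l_iq_i+\sqrt{\frac{\sum_{i=1}^H q_i^2/p_i}{4m\delta}},\qquad Q=(q_1,\dots,q_H)\in\Delta^H,$$ is a strictly convex function on $\Delta^H$, and hence the problem $\min_{Q\in\Delta^H}B_{\mathrm{lin},\chi^2}(Q)$ is a convex program with a unique global minimum.
   Context: $\Delta^H=\{(q_1,\dots,q_H):q_i\ge0,\ \sum_{i=1}^Hq_i=1\}$. $P=(p_1,\dots,p_H)$ is a prior distribution with $p_i>0$ and $\sum_ip_i=1$; $\hat l_1,\dots,\hat l_H\in[0,1]$ are empirical risks; $m\ge1$ is an integer (sample size); $\delta\in(0,1)$. *)

theory Defs
  imports "HOL-Analysis.Analysis"
begin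

text \<open>Distributions on \<open>H\<close> hypotheses are vectors in \<open>real ^ 'h\<close>, with \<open>H = CARD('h)\<close>.\<close>

definition prob_simplex :: "(real ^ 'h) set" where
  "prob_simplex = {q. (\<forall>i. 0 \<le> q $ i) \<and> (\<Sum>i\<in>UNIV. q $ i) = 1}"

text \<open>As in \<^const>\<open>convex_on\<close>, the domain is required to be convex.\<close>

definition strictly_convex_on :: "'a::real_vector set \<Rightarrow> ('a \<Rightarrow> real) \<Rightarrow> bool" where
  "strictly_convex_on S f \<longleftrightarrow> convex S \<and>
    (\<forall>x\<in>S. \<forall>y\<in>S. \<forall>u>0. \<forall>v>0. x \<noteq> y \<longrightarrow> u + v = 1 \<longrightarrow>
      f (u *\<^sub>R x + v *\<^sub>R y) < u * f x + v * f y)"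

text \<open>The problem of minimizing \<open>f\<close> over the feasible set \<open>S\<close> is a convex program.
  The first conjunct is implied by the second and is spelled out for readability only.\<close>

definition convex_program :: "'a::real_vector set \<Rightarrow> ('a \<Rightarrow> real) \<Rightarrow> bool" where
  "convex_program S f \<longleftrightarrow> convex S \<and> convex_on S f"

definition B_lin_chi2 :: "real ^ 'h \<Rightarrow> real ^ 'h \<Rightarrow> nat \<Rightarrow> real \<Rightarrow> real ^ 'h \<Rightarrow> real" where
  "B_lin_chi2 l p m \<delta> q =
    (\<Sum>i\<in>UNIV. l $ i * q $ i) + sqrt ((\<Sum>i\<in>UNIV. (q $ i)\<^sup>2 / p $ i) / (4 * real m * \<delta>))"

end

theory Submission
  imports Defs
begin

text \<open>
  With \<open>c = 4 * m * \<delta>\<close> and \<open>T\<close> the diagonal linear map that divides the \<open>i\<close>-th coordinate by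
  \<open>sqrt (c * p $ i)\<close>, the square root in the bound is the Euclidean norm of \<open>T q\<close>. The bound is
  therefore a linear function plus \<open>norm (T q)\<close>.

  A norm is convex but never strictly convex on a whole space, because it is linear along rays. In a
  Euclidean space, however, rays from the origin are the only obstruction: the triangle inequality
  is strict unless the two vectors are nonnegative multiples of each other. Since \<open>T\<close> is
  injective, equality for \<open>T x\<close> and \<open>T y\<close> puts \<open>x\<close> and \<open>y\<close> on a common ray, and a ray from the
  origin meets the hyperplane of vectors with coordinate sum \<open>1\<close> at most once. So \<open>norm (T q)\<close> is
  strictly convex on the simplex (\<open>strictly_convex_on_norm_linear\<close>), and adding a linear function
  does not change that.

  The minimum exists because the simplex is compact and the bound continuous, and it is unique
  because the midpoint of two distinct minimizers would have a smaller value
  (\<open>strictly_convex_on_ex1_arg_min\<close>).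
\<close>

lemma strictly_convex_on_imp_convex_on:
  assumes "strictly_convex_on S f"
  shows "convex_on S f"
proof (rule convex_onI)
  show "convex S"
    using assms by (simp add: strictly_convex_on_def)
next
  fix t :: real and x y
  assume t: "0 < t" "t < 1" and xy: "x \<in> S" "y \<in> S"
  show "f ((1 - t) *\<^sub>R x + t *\<^sub>R y) \<le> (1 - t) * f x + t * f y"
  proof (cases "x = y")
    case True
    then show ?thesis
      by (simp add: algebra_simps flip: scaleR_add_left)
  next
    case False
    with assms t xy have "f ((1 - t) *\<^sub>R x + t *\<^sub>R y) < (1 - t) * f x + t * f y"
      by (simp add: strictly_convex_on_def)
    then show ?thesis by simp
  qed
qed

lemma strictly_convex_on_add_linear:
  assumes f: "strictly_convex_on S f" and g: "linear g"
  shows "strictly_convex_on S (\<lambda>x. g x + f x)"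
  using f by (simp add: strictly_convex_on_def linear_add[OF g] linear_scale[OF g] algebra_simps)

text \<open>
  The functional \<open>s\<close> confines \<open>S\<close> to a hyperplane that misses the origin, so that distinct points
  of \<open>S\<close> lie on distinct rays.
\<close>

lemma strictly_convex_on_norm_linear:
  fixes T :: "'a::real_vector \<Rightarrow> 'b::real_inner" and s :: "'a \<Rightarrow> real"
  assumes S: "convex S" and T: "linear T" "inj T"
    and s: "linear s" "\<And>x. x \<in> S \<Longrightarrow> s x = 1"
  shows "strictly_convex_on S (\<lambda>x. norm (T x))"
  unfolding strictly_convex_on_def
proof (intro conjI ballI allI impI)
  fix x y and u v :: real
  assume xy: "x \<in> S" "y \<in> S" "x \<noteq> y" and uv: "0 < u" "0 < v" "u + v = 1"
  have "norm (u *\<^sub>R T x + v *\<^sub>R T y) \<noteq> norm (u *\<^sub>R T x) + norm (v *\<^sub>R T y)"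
  proof
    assume "norm (u *\<^sub>R T x + v *\<^sub>R T y) = norm (u *\<^sub>R T x) + norm (v *\<^sub>R T y)"
    then have "norm (u *\<^sub>R T x) *\<^sub>R (v *\<^sub>R T y) = norm (v *\<^sub>R T y) *\<^sub>R (u *\<^sub>R T x)"
      by (simp only: norm_triangle_eq)
    then have "(u * v) *\<^sub>R (norm (T x) *\<^sub>R T y) = (u * v) *\<^sub>R (norm (T y) *\<^sub>R T x)"
      using uv by (simp add: mult_ac)
    then have "norm (T x) *\<^sub>R T y = norm (T y) *\<^sub>R T x"
      using uv by (simp only: scaleR_cancel_left) simp
    then have "T (norm (T x) *\<^sub>R y) = T (norm (T y) *\<^sub>R x)"
      by (simp add: linear_scale[OF T(1)])
    then have ray: "norm (T x) *\<^sub>R y = norm (T y) *\<^sub>R x"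
      using T(2) by (simp add: inj_eq)
    \<comment> \<open>Since \<open>s x = s y = 1\<close>, applying \<open>s\<close> turns a common ray into equal lengths.\<close>
    then have "s (norm (T x) *\<^sub>R y) = s (norm (T y) *\<^sub>R x)"
      by simp
    then have "norm (T x) = norm (T y)"
      using xy s by (simp add: linear_scale)
    with ray xy have "T x = 0" "T y = 0"
      by auto
    with T(2) xy show False
      by (metis injD)
  qed
  with norm_triangle_ineq[of "u *\<^sub>R T x" "v *\<^sub>R T y"]
  show "norm (T (u *\<^sub>R x + v *\<^sub>R y)) < u * norm (T x) + v * norm (T y)"
    using uv by (simp add: linear_add[OF T(1)] linear_scale[OF T(1)])
qed (fact S)

lemma strictly_convex_on_ex1_arg_min:
  fixes f :: "'a::{real_vector,topological_space} \<Rightarrow> real"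
  assumes f: "strictly_convex_on S f" and S: "compact S" "S \<noteq> {}" and cont: "continuous_on S f"
  shows "\<exists>!x. is_arg_min f (\<lambda>x. x \<in> S) x"
proof -
  obtain x where x: "x \<in> S" "\<And>y. y \<in> S \<Longrightarrow> f x \<le> f y"
    using continuous_attains_inf[OF S cont] by blast
  show ?thesis
  proof (rule ex1I)
    show "is_arg_min f (\<lambda>x. x \<in> S) x"
      using x by (force simp: is_arg_min_def)
  next
    fix y
    assume "is_arg_min f (\<lambda>x. x \<in> S) y"
    then have y: "y \<in> S" "f y \<le> f x"
      using x(1) by (auto simp: is_arg_min_def not_less)
    show "y = x"
    proof (rule ccontr)
      let ?z = "(1/2) *\<^sub>R y + (1/2) *\<^sub>R x"
      assume "y \<noteq> x"
      then have "f ?z < (1/2) * f y + (1/2) * f x"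
        using f[unfolded strictly_convex_on_def, THEN conjunct2, rule_format, of y x "1/2" "1/2"]
          x(1) y(1) by simp
      moreover have "?z \<in> S"
        using f x(1) y(1) by (intro convexD) (auto simp: strictly_convex_on_def)
      ultimately show False
        using x(2)[of ?z] y(2) by linarith
    qed
  qed
qed

lemma linear_sum_cart: "linear (\<lambda>q :: real ^ 'h. \<Sum>i\<in>UNIV. q $ i)"
  by (rule linearI) (simp_all add: sum.distrib sum_distrib_left)

lemma convex_prob_simplex: "convex (prob_simplex :: (real ^ 'h) set)"
  by (auto simp: convex_def prob_simplex_def sum.distrib simp flip: sum_distrib_left)

lemma compact_prob_simplex: "compact (prob_simplex :: (real ^ 'h) set)"
proof -
  have "norm q \<le> 1" if "q \<in> prob_simplex" for q :: "real ^ 'h"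
    using norm_le_l1_cart[of q] that by (simp add: prob_simplex_def)
  then have "bounded (prob_simplex :: (real ^ 'h) set)"
    by (auto simp: bounded_iff)
  moreover have "closed (prob_simplex :: (real ^ 'h) set)"
    unfolding prob_simplex_def
    by (intro closed_Collect_conj closed_Collect_all closed_Collect_le closed_Collect_eq
        continuous_intros)
  ultimately show ?thesis
    by (simp add: compact_eq_bounded_closed)
qed

theorem theorem3:
  fixes l p :: "real ^ 'h" and m :: nat and \<delta> :: real
  assumes "\<And>i. 0 < p $ i" and "(\<Sum>i\<in>UNIV. p $ i) = 1"
    and "\<And>i. 0 \<le> l $ i \<and> l $ i \<le> 1"
    and "1 \<le> m"
    and "0 < \<delta>" and "\<delta> < 1"
  shows "strictly_convex_on prob_simplex (B_lin_chi2 l p m \<delta>)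
    \<and> convex_program prob_simplex (B_lin_chi2 l p m \<delta>)
    \<and> (\<exists>!q. is_arg_min (B_lin_chi2 l p m \<delta>) (\<lambda>q. q \<in> prob_simplex) q)"
proof -
  define c where "c = 4 * real m * \<delta>"
  define T :: "real ^ 'h \<Rightarrow> real ^ 'h" where "T q = (\<chi> i. q $ i / sqrt (c * p $ i))" for q
  have c: "0 < c * p $ i" for i
    using assms(1)[of i] assms(4,5) by (simp add: c_def)
  have T: "linear T"
    by (rule linearI) (simp_all add: T_def vec_eq_iff add_divide_distrib)
  have "inj T"
    using c assms(1) by (auto intro!: injI simp: T_def vec_eq_iff less_imp_neq[symmetric])
  have "norm (T q) = sqrt ((\<Sum>i\<in>UNIV. (q $ i)\<^sup>2 / p $ i) / c)" for q
    using c by (simp add: T_def norm_vec_def L2_set_def sum_divide_distrib power_divide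
        less_imp_le mult.commute)
  then have B: "B_lin_chi2 l p m \<delta> = (\<lambda>q. l \<bullet> q + norm (T q))"
    by (simp add: B_lin_chi2_def inner_vec_def c_def fun_eq_iff)
  have "strictly_convex_on prob_simplex (\<lambda>q. norm (T q))"
    by (rule strictly_convex_on_norm_linear[OF convex_prob_simplex T \<open>inj T\<close> linear_sum_cart])
      (simp add: prob_simplex_def)
  then have strict: "strictly_convex_on prob_simplex (B_lin_chi2 l p m \<delta>)"
    unfolding B by (intro strictly_convex_on_add_linear bounded_linear.linear bounded_linear_inner_right)
  moreover have "convex_program prob_simplex (B_lin_chi2 l p m \<delta>)"
    using strictly_convex_on_imp_convex_on[OF strict] convex_prob_simplex
    by (simp add: convex_program_def)
  moreover have "\<exists>!q. is_arg_min (B_lin_chi2 l p m \<delta>) (\<lambda>q. q \<in> prob_simplex) q"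
  proof (rule strictly_convex_on_ex1_arg_min[OF strict compact_prob_simplex])
    have "p \<in> prob_simplex"
      using assms(1,2) by (simp add: prob_simplex_def less_imp_le)
    then show "(prob_simplex :: (real ^ 'h) set) \<noteq> {}"
      by blast
    show "continuous_on prob_simplex (B_lin_chi2 l p m \<delta>)"
      unfolding B using T
      by (intro continuous_intros linear_continuous_on linear_linear[THEN iffD2])
  qed
  ultimately show ?thesis
    by blast
qed

end
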